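(* The Hamiltonian path problem (given a digraph $D$, decide whether $D$ contains a Hamiltonian path) can be solved in time $\mathcal{O}(n^2)$ when restricted to inputs $D$ that are semicomplete multipartite digraphs with independence number at most 2, where $n=|V(D)|$.
   Context: All digraphs are finite and simple: no loops and no parallel arcs, but both arcs $vw$ and $wv$ may be present. A semicomplete multipartite digraph is a digraph $D$ whose vertex set is partitioned into color classes $V_1,\dots,V_c$ such that, for every pair of distinct vertices, there is at least one arc between them if and only if they lie in different color classes. The independence number is that of the underlying undirected graph, i.e. $\max_i|V_i|$. A Hamiltonian path is a directed path containing all vertices; its start and end vertices are not prescribed. *)

theory Defs
  imports
    "Graph_Theory.Pair_Digraph"
    "Graph_Theory.Vertex_Walk"
    "HOL-Library.Disjoint_Sets"
    "HOL-Library.Landau_Symbols"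
begin

section \<open>Digraphs\<close>

text \<open>
  Finite digraphs without loops and parallel arcs are the instances of the locale
  \<^locale>\<open>pair_digraph\<close>; both \<open>(u, v)\<close> and \<open>(v, u)\<close> may be arcs.
\<close>

definition semicomplete_multipartite :: "'a pair_pre_digraph \<Rightarrow> bool" where
  "semicomplete_multipartite D \<longleftrightarrow> pair_digraph D \<and>
     (\<exists>\<C>. partition_on (pverts D) \<C> \<and>
        (\<forall>u \<in> pverts D. \<forall>v \<in> pverts D. u \<noteq> v \<longrightarrow>
           ((u \<rightarrow>\<^bsub>D\<^esub> v \<or> v \<rightarrow>\<^bsub>D\<^esub> u) \<longleftrightarrow> \<not> (\<exists>C \<in> \<C>. u \<in> C \<and> v \<in> C))))"

definition independent_in :: "'a pair_pre_digraph \<Rightarrow> 'a set \<Rightarrow> bool" where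
  "independent_in D S \<longleftrightarrow> S \<subseteq> pverts D \<and> (\<forall>u \<in> S. \<forall>v \<in> S. \<not> u \<rightarrow>\<^bsub>D\<^esub> v)"

definition independence_number :: "'a pair_pre_digraph \<Rightarrow> nat" where
  "independence_number D = Max (card ` {S. independent_in D S})"

definition has_hamiltonian_path :: "'a pair_pre_digraph \<Rightarrow> bool" where
  "has_hamiltonian_path D \<longleftrightarrow> (\<exists>p. vpath p D \<and> set p = pverts D)"


section \<open>A word RAM\<close>

text \<open>
  Programs are finite pieces of syntax over registers and a randomly addressable memory of
  natural numbers. Every expression node and every executed command costs one unit of time,
  so the constant operations cost \<open>O(1)\<close>. To exclude computing with huge numbers at unit
  cost, all values that arise (constants, addresses and intermediate results included) have
  to be smaller than a bound \<open>W\<close>; an execution that exceeds the bound is stuck.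
\<close>

datatype expr =
    Const nat
  | Reg nat
  | Load expr
  | Add expr expr
  | Sub expr expr
  | Mul expr expr
  | Eq expr expr
  | Less expr expr

datatype com =
    Skip
  | Assign nat expr
  | Store expr expr
  | Seq com com
  | Cond expr com com
  | While expr com

record store =
  reg :: "nat \<Rightarrow> nat"
  mem :: "nat \<Rightarrow> nat"

text \<open>Subtraction is truncated at \<open>0\<close>; truth values are \<open>0\<close> and \<open>1\<close>.\<close>

primrec val :: "store \<Rightarrow> expr \<Rightarrow> nat" where
  "val s (Const k) = k"
| "val s (Reg r) = reg s r"
| "val s (Load e) = mem s (val s e)"
| "val s (Add e f) = val s e + val s f"
| "val s (Sub e f) = val s e - val s f"
| "val s (Mul e f) = val s e * val s f"
| "val s (Eq e f) = of_bool (val s e = val s f)"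
| "val s (Less e f) = of_bool (val s e < val s f)"

primrec subexprs :: "expr \<Rightarrow> expr set" where
  "subexprs (Const k) = {Const k}"
| "subexprs (Reg r) = {Reg r}"
| "subexprs (Load e) = insert (Load e) (subexprs e)"
| "subexprs (Add e f) = insert (Add e f) (subexprs e \<union> subexprs f)"
| "subexprs (Sub e f) = insert (Sub e f) (subexprs e \<union> subexprs f)"
| "subexprs (Mul e f) = insert (Mul e f) (subexprs e \<union> subexprs f)"
| "subexprs (Eq e f) = insert (Eq e f) (subexprs e \<union> subexprs f)"
| "subexprs (Less e f) = insert (Less e f) (subexprs e \<union> subexprs f)"

definition fits :: "nat \<Rightarrow> store \<Rightarrow> expr \<Rightarrow> bool" where
  "fits W s e \<longleftrightarrow> (\<forall>f \<in> subexprs e. val s f < W)"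

primrec cost :: "expr \<Rightarrow> nat" where
  "cost (Const k) = 1"
| "cost (Reg r) = 1"
| "cost (Load e) = 1 + cost e"
| "cost (Add e f) = 1 + cost e + cost f"
| "cost (Sub e f) = 1 + cost e + cost f"
| "cost (Mul e f) = 1 + cost e + cost f"
| "cost (Eq e f) = 1 + cost e + cost f"
| "cost (Less e f) = 1 + cost e + cost f"

text \<open>\<open>exec W c s t s'\<close>: with word bound \<open>W\<close>, command \<open>c\<close> started in \<open>s\<close> halts in \<open>s'\<close>
  after exactly \<open>t\<close> units of time.\<close>

inductive exec :: "nat \<Rightarrow> com \<Rightarrow> store \<Rightarrow> nat \<Rightarrow> store \<Rightarrow> bool" for W where
  exec_Skip: "exec W Skip s 1 s"
| exec_Assign: "fits W s e \<Longrightarrow>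
    exec W (Assign r e) s (1 + cost e) (s\<lparr>reg := (reg s)(r := val s e)\<rparr>)"
| exec_Store: "\<lbrakk>fits W s e; fits W s f\<rbrakk> \<Longrightarrow>
    exec W (Store e f) s (1 + cost e + cost f) (s\<lparr>mem := (mem s)(val s e := val s f)\<rparr>)"
| exec_Seq: "\<lbrakk>exec W c s t s'; exec W d s' t' s''\<rbrakk> \<Longrightarrow> exec W (Seq c d) s (1 + t + t') s''"
| exec_Cond_true: "\<lbrakk>fits W s e; val s e \<noteq> 0; exec W c s t s'\<rbrakk> \<Longrightarrow>
    exec W (Cond e c d) s (1 + cost e + t) s'"
| exec_Cond_false: "\<lbrakk>fits W s e; val s e = 0; exec W d s t s'\<rbrakk> \<Longrightarrow>
    exec W (Cond e c d) s (1 + cost e + t) s'"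
| exec_While_true: "\<lbrakk>fits W s e; val s e \<noteq> 0; exec W c s t s'; exec W (While e c) s' t' s''\<rbrakk> \<Longrightarrow>
    exec W (While e c) s (1 + cost e + t + t') s''"
| exec_While_false: "\<lbrakk>fits W s e; val s e = 0\<rbrakk> \<Longrightarrow> exec W (While e c) s (1 + cost e) s"

inductive_cases exec_SkipE: "exec W Skip s t s'"
inductive_cases exec_AssignE: "exec W (Assign r e) s t s'"
inductive_cases exec_StoreE: "exec W (Store e f) s t s'"
inductive_cases exec_SeqE: "exec W (Seq c d) s t s'"
inductive_cases exec_CondE: "exec W (Cond e c d) s t s'"
inductive_cases exec_WhileE: "exec W (While e c) s t s'"

lemma exec_deterministic:
  assumes "exec W c s t s'" "exec W c s u s''"
  shows "t = u \<and> s' = s''"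
  using assms
proof (induction arbitrary: u s'' rule: exec.induct)
  case (exec_Seq c s t s' d t' s2)
  from exec_Seq.prems obtain u1 r u2 where
    u: "exec W c s u1 r" "exec W d r u2 s''" "u = 1 + u1 + u2"
    by (auto elim: exec_SeqE)
  from exec_Seq.IH(1)[OF u(1)] exec_Seq.IH(2) u(2,3) show ?case by simp
next
  case (exec_Cond_true s e c t s' d)
  from exec_Cond_true.prems exec_Cond_true.hyps(2) obtain u1 where
    u: "exec W c s u1 s''" "u = 1 + cost e + u1"
    by (auto elim: exec_CondE)
  from exec_Cond_true.IH[OF u(1)] u(2) show ?case by simp
next
  case (exec_Cond_false s e d t s' c)
  from exec_Cond_false.prems exec_Cond_false.hyps(2) obtain u1 where
    u: "exec W d s u1 s''" "u = 1 + cost e + u1"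
    by (auto elim: exec_CondE)
  from exec_Cond_false.IH[OF u(1)] u(2) show ?case by simp
next
  case (exec_While_true s e c t s' t' s2)
  from exec_While_true.prems exec_While_true.hyps(2) obtain u1 r u2 where
    u: "exec W c s u1 r" "exec W (While e c) r u2 s''" "u = 1 + cost e + u1 + u2"
    by (auto elim: exec_WhileE)
  from exec_While_true.IH(1)[OF u(1)] exec_While_true.IH(2) u(2,3) show ?case by simp
next
  case (exec_While_false s e c)
  from exec_While_false.prems exec_While_false.hyps(2) show ?case
    by (auto elim: exec_WhileE)
qed (auto elim: exec_SkipE exec_AssignE exec_StoreE)


section \<open>Decision problems on digraphs\<close>

text \<open>
  A digraph is presented as its adjacency matrix with respect to an enumeration \<open>vs\<close> of its
  vertices: register \<open>0\<close> holds \<open>n\<close>, cell \<open>i * n + j\<close> with \<open>i, j < n\<close> tells whether there is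
  an arc from the \<open>i\<close>-th to the \<open>j\<close>-th vertex, and everything else is \<open>0\<close>.
\<close>

definition adjacency_input :: "'a pair_pre_digraph \<Rightarrow> 'a list \<Rightarrow> store" where
  "adjacency_input D vs = (let n = length vs in
     \<lparr>reg = (\<lambda>r. if r = 0 then n else 0),
      mem = (\<lambda>a. of_bool (a < n * n \<and> vs ! (a div n) \<rightarrow>\<^bsub>D\<^esub> vs ! (a mod n)))\<rparr>)"

text \<open>
  \<open>problem\<close> can be decided in time \<open>O(f(n))\<close> on the inputs satisfying \<open>inputs\<close>: one program
  works for all inputs, with words of \<open>O(log n)\<close> bits, and leaves its answer in
  register \<open>0\<close>. Nothing is required outside of \<open>inputs\<close>. Vertices are natural numbers only
  to have all finite digraphs, up to renaming of vertices, in one type.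
\<close>

definition solvable_in_time_on ::
  "(nat pair_pre_digraph \<Rightarrow> bool) \<Rightarrow> (nat \<Rightarrow> real) \<Rightarrow> (nat pair_pre_digraph \<Rightarrow> bool) \<Rightarrow> bool" where
  "solvable_in_time_on problem f inputs \<longleftrightarrow>
     (\<exists>prog k. \<exists>T :: nat \<Rightarrow> nat. (\<lambda>n. real (T n)) \<in> O(f) \<and>
        (\<forall>D vs. pair_digraph D \<and> inputs D \<and> distinct vs \<and> set vs = pverts D \<longrightarrow>
           (\<exists>t s. exec ((length vs + 2) ^ k) prog (adjacency_input D vs) t s \<and>
              t \<le> T (card (pverts D)) \<and> (reg s 0 \<noteq> 0 \<longleftrightarrow> problem D))))"

end

theory Submission
  imports Defs
begin

text \<open>
  In a semicomplete multipartite digraph with independence number at most 2, every vertex is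
  nonadjacent to at most one other vertex. Such a digraph fails to have a spanning path only for
  the obvious reason that there are two vertices neither of which reaches the other, and this
  reason is visible in the indegrees.

  Take a longest path \<open>p\<close> and a vertex \<open>v\<close> outside of it. If \<open>v\<close> were adjacent to all of \<open>p\<close>, it
  could be inserted somewhere, so it has a nonneighbour \<open>w\<close> on \<open>p = P @ w # Q\<close>. Trying to insert
  \<open>v\<close>, to exchange \<open>v\<close> with \<open>w\<close>, and to detour through \<open>v\<close> along an arc from \<open>Q\<close> back to \<open>P\<close>
  shows that all arcs go from \<open>P\<close> to \<open>v\<close> and \<open>w\<close>, from these to \<open>Q\<close>, and never from \<open>Q\<close> to \<open>P\<close>
  (\<open>twins_cut_longest_path\<close>). The remaining vertices outside of \<open>p\<close> behave in the same way, and
  the arcs among them follow the order of their nonneighbours on \<open>p\<close> (\<open>twin_pairs_ordered\<close>).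
  Hence all vertices except \<open>v\<close> and \<open>w\<close> split into sets \<open>A\<close> and \<open>B\<close> without arcs from
  \<open>A \<union> {v, w}\<close> to \<open>B \<union> {v, w}\<close>.

  Counting in-neighbours, \<open>v\<close> and \<open>w\<close> have indegree \<open>k = card B\<close>, the vertices in \<open>B\<close> have a
  smaller and those in \<open>A\<close> a larger indegree (\<open>indegrees_across_twins\<close>). So there is no spanning
  path if and only if for some \<open>k\<close> at least two vertices have indegree \<open>k\<close> and no arc leads from a
  vertex of indegree at least \<open>k\<close> to a vertex of indegree at most \<open>k\<close>
  (\<open>spanning_path_iff_no_cut\<close>).

  This criterion costs quadratic time: compute all indegrees, then for every vertex the largest
  indegree of an in-neighbour, and then test every \<open>k\<close> by a linear scan over the vertices.
  The program \<open>hamiltonian_path_prog\<close> consists of these three doubly nested loops.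
\<close>

section \<open>Spanning paths when every vertex has at most one nonneighbour\<close>

text \<open>
  There is room for \<open>v\<close> directly before the first element that it sends an arc to, because all
  earlier elements send arcs to \<open>v\<close>. This keeps the last element of the list, so what follows the
  list in a longer path is not affected.
\<close>

lemma insert_before_successor:
  assumes "successively R xs" and "\<forall>x \<in> set xs. R x v \<or> R v x" and "y \<in> set xs" and "R v y"
  shows "\<exists>as bs. xs = as @ bs \<and> bs \<noteq> [] \<and> successively R (as @ v # bs)"
  using assms
proof (induction xs)
  case (Cons a xs)
  show ?case
  proof (cases "R v a")
    case True
    with Cons.prems have "successively R ([] @ v # a # xs)" by simp
    then show ?thesis by blast
  next
    case False
    with Cons.prems have "R a v" "y \<in> set xs" "successively R xs"
      by (auto simp: successively_Cons)
    with Cons obtain as bs where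
      *: "xs = as @ bs" "bs \<noteq> []" "successively R (as @ v # bs)" by auto
    with Cons.prems(1) \<open>R a v\<close> have "successively R ((a # as) @ v # bs)"
      by (cases as) (auto simp: successively_Cons)
    with * show ?thesis by (metis append_Cons)
  qed
qed simp

text \<open>
  The mirror image; here the first element is kept.
\<close>

lemma insert_after_predecessor:
  assumes "successively R xs" and "\<forall>x \<in> set xs. R x v \<or> R v x" and "y \<in> set xs" and "R y v"
  shows "\<exists>as bs. xs = as @ bs \<and> as \<noteq> [] \<and> successively R (as @ v # bs)"
proof -
  have "successively (\<lambda>x y. R y x) (rev xs)" using assms(1) by simp
  then obtain bs as where
    *: "rev xs = bs @ as" "as \<noteq> []" "successively (\<lambda>x y. R y x) (bs @ v # as)"
    using insert_before_successor[of "\<lambda>x y. R y x" "rev xs" v y] assms by auto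
  from *(1) have "xs = rev as @ rev bs" by (metis rev_append rev_rev_ident)
  moreover have "successively R (rev (bs @ v # as))" using *(3) by (simp only: successively_rev)
  then have "successively R (rev as @ v # rev bs)" by simp
  ultimately show ?thesis using *(2) by blast
qed

text \<open>
  Complete multipartite graphs with classes of size at most 2 are complete graphs minus a matching;
  the orientation of the edges and the presence of antiparallel arcs are arbitrary.
\<close>

locale near_semicomplete =
  fixes V :: "'a set" and R :: "'a \<Rightarrow> 'a \<Rightarrow> bool"
  assumes finite_V: "finite V"
    and irrefl: "\<not> R x x"
    and one_nonneighbour: "\<lbrakk>x \<in> V; y \<in> V; z \<in> V; y \<noteq> x; z \<noteq> x; y \<noteq> z\<rbrakk> \<Longrightarrow>
      R x y \<or> R y x \<or> R x z \<or> R z x"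
begin

definition nonadj :: "'a \<Rightarrow> 'a \<Rightarrow> bool" where
  "nonadj x y \<longleftrightarrow> \<not> R x y \<and> \<not> R y x"

definition path :: "'a list \<Rightarrow> bool" where
  "path p \<longleftrightarrow> distinct p \<and> set p \<subseteq> V \<and> successively R p"

definition longest_path :: "'a list \<Rightarrow> bool" where
  "longest_path p \<longleftrightarrow> path p \<and> (\<forall>q. path q \<longrightarrow> length q \<le> length p)"

abbreviation indegree :: "'a \<Rightarrow> nat" where
  "indegree x \<equiv> card {u \<in> V. R u x}"

lemma nonadj_sym: "nonadj x y \<Longrightarrow> nonadj y x"
  by (simp add: nonadj_def)

lemma nonadj_unique:
  "\<lbrakk>nonadj x y; nonadj x z; x \<in> V; y \<in> V; z \<in> V; y \<noteq> x; z \<noteq> x\<rbrakk> \<Longrightarrow> y = z"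
  using one_nonneighbour by (metis nonadj_def)

lemma adjacent_to_others:
  "\<lbrakk>nonadj x y; x \<in> V; y \<in> V; z \<in> V; y \<noteq> x; z \<noteq> x; z \<noteq> y\<rbrakk> \<Longrightarrow> R x z \<or> R z x"
  using one_nonneighbour by (metis nonadj_def)

lemma longest_path_exists: "\<exists>p. longest_path p"
proof -
  have "path []" by (simp add: path_def)
  moreover have "\<forall>q. path q \<longrightarrow> length q < Suc (card V)"
  proof (intro allI impI)
    fix q assume "path q"
    then show "length q < Suc (card V)"
      using card_mono[OF finite_V, of "set q"] distinct_card[of q] by (simp add: path_def)
  qed
  ultimately show ?thesis
    unfolding longest_path_def by (rule ex_has_greatest_nat)
qed

lemma no_longer_path:
  assumes "longest_path p" and "distinct q" and "set q \<subseteq> V" and "successively R q"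
  shows "length q \<le> length p"
  using assms by (auto simp: longest_path_def path_def)

text \<open>
  A vertex that is adjacent to all of \<open>p\<close> fits before some vertex of \<open>p\<close> or at its end.
\<close>

lemma nonneighbour_on_longest_path:
  assumes p: "longest_path p" and v: "v \<in> V" "v \<notin> set p"
  shows "\<exists>w \<in> set p. nonadj v w"
proof (rule ccontr)
  assume "\<not> ?thesis"
  then have adj: "\<forall>x \<in> set p. R x v \<or> R v x" by (auto simp: nonadj_def)
  have p': "distinct p" "set p \<subseteq> V" "successively R p"
    using p by (auto simp: longest_path_def path_def)
  have "\<exists>as bs. p = as @ bs \<and> successively R (as @ v # bs)"
  proof (cases "\<exists>y \<in> set p. R v y")
    case True
    with insert_before_successor[OF p'(3) adj] show ?thesis by blast
  next
    case False
    with adj have "p \<noteq> [] \<Longrightarrow> R (last p) v" by auto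
    with p'(3) have "successively R (p @ v # [])" by (auto simp: successively_append_iff)
    then show ?thesis by (metis append_Nil2)
  qed
  then obtain as bs where "p = as @ bs" "successively R (as @ v # bs)" by blast
  with no_longer_path[OF p, of "as @ v # bs"] p' v show False by auto
qed

text \<open>
  Every arc that is excluded here would give a longer path. An arc from \<open>v\<close> to \<open>P\<close> or from \<open>Q\<close>
  to \<open>v\<close> allows to insert \<open>v\<close> into \<open>P\<close> or \<open>Q\<close>. Otherwise \<open>v\<close> can replace \<open>w\<close> between \<open>P\<close> and \<open>Q\<close>,
  and the same argument applies to \<open>w\<close>. Then \<open>v\<close> and \<open>w\<close> have the same in- and out-neighbours on
  the path, and an arc from \<open>y \<in> set Q\<close> to \<open>x \<in> set P\<close> permits to pass from \<open>P\<close> to \<open>Q\<close> twice,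
  once through \<open>v\<close> and once through \<open>w\<close>.
\<close>

lemma twins_cut_longest_path:
  assumes p: "longest_path (P @ w # Q)" and v: "v \<in> V" "v \<notin> set (P @ w # Q)"
    and vw: "nonadj v w"
  shows "\<forall>x \<in> set P. \<not> R v x" "\<forall>y \<in> set Q. \<not> R y v"
    "\<forall>x \<in> set P. R x v" "\<forall>y \<in> set Q. R v y"
    "\<forall>x \<in> set P. \<not> R w x" "\<forall>y \<in> set Q. \<not> R y w"
    "\<forall>x \<in> set P. \<forall>y \<in> set Q. \<not> R y x"
proof -
  note longer = no_longer_path[OF p]
  have p': "distinct (P @ w # Q)" "set (P @ w # Q) \<subseteq> V" "successively R (P @ w # Q)"
    using p by (auto simp: longest_path_def path_def)
  have succ: "successively R P" "successively R Q" "P \<noteq> [] \<Longrightarrow> R (last P) w"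
    "Q \<noteq> [] \<Longrightarrow> R w (hd Q)"
    using p'(3) by (auto simp: successively_append_iff successively_Cons)
  have adj_v: "R x v \<or> R v x" if "x \<in> set P \<union> set Q" for x
    using adjacent_to_others[OF vw, of x] that v p' by auto
  have adj_w: "R x w \<or> R w x" if "x \<in> set P \<union> set Q" for x
    using adjacent_to_others[OF nonadj_sym[OF vw], of x] that v p' by auto
  show P_v: "\<forall>x \<in> set P. \<not> R v x"
  proof (intro ballI notI)
    fix x assume "x \<in> set P" "R v x"
    then obtain as bs where *: "P = as @ bs" "bs \<noteq> []" "successively R (as @ v # bs)"
      using insert_before_successor[OF succ(1)] adj_v by blast
    with p'(3) have "successively R (as @ v # bs @ w # Q)"
      by (auto simp: successively_append_iff successively_Cons)
    with longer[of "as @ v # bs @ w # Q"] * p' v show False by auto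
  qed
  show Q_v: "\<forall>y \<in> set Q. \<not> R y v"
  proof (intro ballI notI)
    fix x assume "x \<in> set Q" "R x v"
    then obtain as bs where *: "Q = as @ bs" "as \<noteq> []" "successively R (as @ v # bs)"
      using insert_after_predecessor[OF succ(2)] adj_v by blast
    with p'(3) have "successively R (P @ w # as @ v # bs)"
      by (auto simp: successively_append_iff successively_Cons)
    with longer[of "P @ w # as @ v # bs"] * p' v show False by auto
  qed
  show v_P: "\<forall>x \<in> set P. R x v" and v_Q: "\<forall>y \<in> set Q. R v y"
    using P_v Q_v adj_v by auto
  show P_w: "\<forall>x \<in> set P. \<not> R w x"
  proof (intro ballI notI)
    fix x assume "x \<in> set P" "R w x"
    then obtain as bs where *: "P = as @ bs" "bs \<noteq> []" "successively R (as @ w # bs)"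
      using insert_before_successor[OF succ(1)] adj_w by blast
    with succ v_P v_Q have "successively R (as @ w # bs @ v # Q)"
      by (cases Q) (auto simp: successively_append_iff successively_Cons)
    with longer[of "as @ w # bs @ v # Q"] * p' v show False by auto
  qed
  show Q_w: "\<forall>y \<in> set Q. \<not> R y w"
  proof (intro ballI notI)
    fix x assume "x \<in> set Q" "R x w"
    then obtain as bs where *: "Q = as @ bs" "as \<noteq> []" "successively R (as @ w # bs)"
      using insert_after_predecessor[OF succ(2)] adj_w by blast
    with succ v_P v_Q have "successively R (P @ v # as @ w # bs)"
      by (cases P rule: rev_cases) (auto simp: successively_append_iff successively_Cons)
    with longer[of "P @ v # as @ w # bs"] * p' v show False by auto
  qed
  have w_P: "\<forall>x \<in> set P. R x w" and w_Q: "\<forall>y \<in> set Q. R w y"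
    using P_w Q_w adj_w by auto
  show "\<forall>x \<in> set P. \<forall>y \<in> set Q. \<not> R y x"
  proof (intro ballI notI)
    fix x y assume "x \<in> set P" "y \<in> set Q" "R y x"
    then obtain P1 P2 Q1 Q2 where PQ: "P = P1 @ x # P2" "Q = Q1 @ y # Q2"
      by (meson split_list)
    \<comment> \<open>the longer path is \<open>P1 @ v # Q1 @ y # x # P2 @ w # Q2\<close>\<close>
    have *: "successively R P1" "successively R (x # P2)" "successively R (Q1 @ [y])" "successively R Q2"
      using succ(1,2) PQ by (auto simp: successively_append_iff successively_Cons)
    have "successively R (w # Q2)"
      using *(4) w_Q PQ(2) by (cases Q2) auto
    then have "successively R ((x # P2) @ w # Q2)"
      using *(2) w_P PQ(1) by (simp only: successively_append_iff) simp
    then have "successively R ((Q1 @ [y]) @ (x # P2) @ w # Q2)"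
      using *(3) \<open>R y x\<close> by (simp only: successively_append_iff) simp
    moreover have "R v (hd (Q1 @ [y]))"
      using v_Q PQ(2) by (cases Q1) auto
    ultimately have "successively R (v # (Q1 @ [y]) @ (x # P2) @ w # Q2)"
      by (cases Q1) (auto simp: successively_Cons)
    then have "successively R (P1 @ v # (Q1 @ [y]) @ (x # P2) @ w # Q2)"
      using *(1) v_P PQ(1) by (cases P1 rule: rev_cases) (auto simp: successively_append_iff)
    moreover have "distinct (P1 @ v # (Q1 @ [y]) @ (x # P2) @ w # Q2)"
      using p'(1) v(2) PQ by auto
    ultimately show False
      using longer[of "P1 @ v # (Q1 @ [y]) @ (x # P2) @ w # Q2"] p'(2) v(1) PQ by auto
  qed
qed

text \<open>
  Otherwise \<open>v\<close> and \<open>v'\<close> could both be inserted directly before \<open>w'\<close>: all of \<open>P @ w # M\<close> sends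
  arcs to \<open>v'\<close>, and \<open>v\<close> sends an arc to \<open>w'\<close>.
\<close>

lemma twin_pairs_ordered:
  assumes p: "longest_path (P @ w # M @ w' # Q)"
    and v: "v \<in> V" "v \<notin> set (P @ w # M @ w' # Q)" "nonadj v w"
    and v': "v' \<in> V" "v' \<notin> set (P @ w # M @ w' # Q)" "nonadj v' w'"
  shows "\<not> R v' v"
proof
  assume "R v' v"
  let ?q = "P @ w # M @ v' # v # w' # Q"
  have p': "distinct (P @ w # M @ w' # Q)" "set (P @ w # M @ w' # Q) \<subseteq> V"
    "successively R (P @ w # M @ w' # Q)"
    using p by (auto simp: longest_path_def path_def)
  have *: "successively R (P @ w # M)" "successively R (w' # Q)"
    using p'(3) successively_append_iff[of R "P @ w # M" "w' # Q"] by simp_all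
  have "R v w'" using twins_cut_longest_path(4)[OF p v] by simp
  with *(2) \<open>R v' v\<close> have "successively R (v' # v # w' # Q)" by simp
  moreover have "\<forall>x \<in> set (P @ w # M). R x v'"
    using twins_cut_longest_path(3)[of "P @ w # M" w' Q v'] p v' by simp
  then have "R (last (P @ w # M)) v'" by (metis last_in_set append_is_Nil_conv list.distinct(1))
  ultimately have "successively R ((P @ w # M) @ v' # v # w' # Q)"
    using *(1) by (simp only: successively_append_iff) simp
  then have "successively R ?q" by simp
  moreover have "v \<noteq> v'" using \<open>R v' v\<close> irrefl by auto
  ultimately show False
    using no_longer_path[OF p, of ?q] p' v v' by auto
qed

text \<open>
  A vertex outside of a path is placed at the position of its nonneighbour. On a longest path this
  gives every vertex exactly one level, and at most two vertices share a level.
\<close>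

definition level :: "'a list \<Rightarrow> nat \<Rightarrow> 'a \<Rightarrow> bool" where
  "level p i x \<longleftrightarrow> i < length p \<and> (x = p ! i \<or> x \<in> V - set p \<and> nonadj x (p ! i))"

lemma level_exists:
  assumes "longest_path p" and "x \<in> V"
  shows "\<exists>i. level p i x"
  using nonneighbour_on_longest_path[OF assms] assms(2)
  by (metis level_def in_set_conv_nth Diff_iff)

lemma level_unique:
  assumes "longest_path p" and "level p i x" and "level p j x"
  shows "i = j"
proof -
  have p: "distinct p" "set p \<subseteq> V" using assms by (auto simp: longest_path_def path_def)
  show ?thesis
  proof (cases "x \<in> set p")
    case True
    with assms p show ?thesis by (auto simp: level_def nth_eq_iff_index_eq)
  next
    case False
    with assms have *: "nonadj x (p ! i)" "nonadj x (p ! j)" "x \<in> V"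
      "p ! i \<in> set p" "p ! j \<in> set p"
      by (auto simp: level_def)
    with False p have "p ! i = p ! j" by (intro nonadj_unique[of x]) auto
    with assms p show ?thesis by (auto simp: level_def nth_eq_iff_index_eq)
  qed
qed

lemma same_level_unique:
  assumes "longest_path p" and "level p i x" and "level p i y" and "x \<notin> set p" and "y \<notin> set p"
  shows "x = y"
proof -
  have p: "set p \<subseteq> V" using assms by (auto simp: longest_path_def path_def)
  from assms have *: "nonadj (p ! i) x" "nonadj (p ! i) y" "x \<in> V" "y \<in> V" "p ! i \<in> set p"
    by (auto simp: level_def intro: nonadj_sym)
  then show ?thesis using nonadj_unique[of "p ! i" x y] assms p by auto
qed

text \<open>
  A level that is occupied twice separates the digraph: no arc leads from this level or a later
  one back to this level or an earlier one.
\<close>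

lemma no_arc_across_twins:
  assumes p: "longest_path p" and v: "level p j v" "v \<notin> set p"
    and a: "level p i a" and b: "level p l b" and le: "l \<le> j" "j \<le> i"
  shows "\<not> R a b"
proof -
  have split: "take i p @ p ! i # drop (Suc i) p = p" if "i < length p" for i
    using id_take_nth_drop[OF that] by (rule sym)
  have before: "p ! k \<in> set (take i p)" if "k < i" "i < length p" for k i
    using that by (auto simp: in_set_conv_nth intro!: exI[of _ k])
  have after: "p ! k \<in> set (drop (Suc i) p)" if "i < k" "k < length p" for k i
    using that by (auto simp: in_set_conv_nth intro!: exI[of _ "k - Suc i"])
  have twin: "longest_path (take i p @ p ! i # drop (Suc i) p)" "u \<in> V"
      "u \<notin> set (take i p @ p ! i # drop (Suc i) p)" "nonadj u (p ! i)"
    if "level p i u" "u \<notin> set p" for i u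
    using that p by (auto simp: level_def split)
  have len: "i < length p" "l < length p" "j < length p"
    using a b v by (auto simp: level_def)
  consider (path) "a = p ! i" "b = p ! l" | (left) "a \<notin> set p" "b = p ! l"
    | (right) "a = p ! i" "b \<notin> set p" | (both) "a \<notin> set p" "b \<notin> set p"
    using a b by (auto simp: level_def)
  then show ?thesis
  proof cases
    case path
    consider "l = i" | "l < j" "j = i" | "l = j" "j < i" | "l < j" "j < i"
      using le by linarith
    then show ?thesis
      unfolding path
      using irrefl twins_cut_longest_path(5-7)[OF twin[OF v]] before[of l j] after[of j i] len
      by cases blast+
  next
    case left
    show ?thesis
    proof (cases "l = i")
      case True
      with left a b show ?thesis by (auto simp: level_def nonadj_def)
    next
      case False
      with left le len twins_cut_longest_path(1)[OF twin[OF a left(1)]] before[of l i]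
      show ?thesis by auto
    qed
  next
    case right
    show ?thesis
    proof (cases "l = i")
      case True
      with right a b show ?thesis by (auto simp: level_def nonadj_def)
    next
      case False
      with right le len twins_cut_longest_path(2)[OF twin[OF b right(2)]] after[of l i]
      show ?thesis by auto
    qed
  next
    case both
    show ?thesis
    proof (cases "l = i")
      case True
      with same_level_unique[OF p] a b both irrefl show ?thesis by blast
    next
      case False
      with le have "l < i" by simp
      have "take l p @ p ! l # drop (Suc l) (take i p) = take i p"
        using id_take_nth_drop[of l "take i p", symmetric] \<open>l < i\<close> len by simp
      then have "(take l p @ p ! l # drop (Suc l) (take i p)) @ p ! i # drop (Suc i) p = p"
        by (simp only: split[OF len(1)])
      then have eq: "take l p @ p ! l # drop (Suc l) (take i p) @ p ! i # drop (Suc i) p = p"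
        by (simp only: append.assoc append_Cons)
      show ?thesis
        using twin_pairs_ordered[of "take l p" "p ! l" "drop (Suc l) (take i p)" "p ! i"
            "drop (Suc i) p" b a] p a b both
        by (simp only: eq) (auto simp: level_def)
    qed
  qed
qed

text \<open>
  All of \<open>B\<close> is adjacent to \<open>v\<close> and \<open>w\<close>, as these are nonadjacent to each other, and hence \<open>B\<close> is
  the set of in-neighbours of both. The in-neighbours of \<open>b \<in> B\<close> form a subset of \<open>B - {b}\<close>. A
  vertex \<open>a \<in> A\<close> receives arcs from all of \<open>B \<union> {v, w}\<close> except at most one vertex, and so from at
  least \<open>card B + 1\<close> vertices.
\<close>

lemma indegrees_across_twins:
  assumes v: "v \<in> V" "w \<in> V" "v \<noteq> w" and V: "V = A \<union> {v, w} \<union> B"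
    and disj: "A \<inter> B = {}" "A \<inter> {v, w} = {}" "B \<inter> {v, w} = {}"
    and no_arc: "\<And>a b. \<lbrakk>a \<in> A \<union> {v, w}; b \<in> B \<union> {v, w}\<rbrakk> \<Longrightarrow> \<not> R a b"
  shows "indegree v = card B" "indegree w = card B"
    "b \<in> B \<Longrightarrow> indegree b < card B" "a \<in> A \<Longrightarrow> card B < indegree a"
proof -
  have finB: "finite B" using V finite_V by simp
  have vw: "nonadj v w" using no_arc by (auto simp: nonadj_def)
  have arcs: "(R x v \<or> R v x) \<and> (R x w \<or> R w x)" if "x \<in> A \<union> B" for x
    using adjacent_to_others[OF vw, of x] adjacent_to_others[OF nonadj_sym[OF vw], of x] that V v disj
    by blast
  have from_B: "R x v" "R x w" if "x \<in> B" for x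
    using arcs[of x] no_arc[of v x] no_arc[of w x] that by blast+
  have to_A: "R v x" "R w x" if "x \<in> A" for x
    using arcs[of x] no_arc[of x v] no_arc[of x w] that by blast+
  have "{u \<in> V. R u v} = B" "{u \<in> V. R u w} = B"
    using V from_B no_arc by blast+
  then show "indegree v = card B" "indegree w = card B" by simp_all
  show "indegree b < card B" if "b \<in> B"
  proof (rule psubset_card_mono[OF finB])
    show "{u \<in> V. R u b} \<subset> B" using V no_arc that irrefl by blast
  qed
  show "card B < indegree a" if "a \<in> A"
  proof -
    define N where "N = {b \<in> B. nonadj a b}"
    have "x = y" if "x \<in> N" "y \<in> N" for x y
      using that nonadj_unique[of a x y] \<open>a \<in> A\<close> disj V by (auto simp: N_def)
    then have "card N \<le> 1"
      using finB by (simp add: card_le_Suc0_iff_eq N_def)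
    moreover have "B \<union> {v, w} \<subseteq> {u \<in> V. R u a} \<union> N"
      using V no_arc[of a] that to_A[OF that] by (auto simp: N_def nonadj_def)
    then have "card (B \<union> {v, w}) \<le> card ({u \<in> V. R u a} \<union> N)"
      by (intro card_mono) (auto simp: N_def finB finite_V)
    then have "card (B \<union> {v, w}) \<le> indegree a + card N"
      using card_Un_le[of "{u \<in> V. R u a}" N] by linarith
    moreover have "card (B \<union> {v, w}) = card B + 2"
      using finB disj v by (subst card_Un_disjoint) auto
    ultimately show ?thesis by linarith
  qed
qed

text \<open>
  The obstruction to a spanning path: the vertices of indegree \<open>k\<close> cannot reach each other.
\<close>

definition cut_at :: "nat \<Rightarrow> bool" where
  "cut_at k \<longleftrightarrow> 2 \<le> card {x \<in> V. indegree x = k} \<and>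
     (\<forall>a \<in> V. \<forall>b \<in> V. R a b \<longrightarrow> \<not> (indegree b \<le> k \<and> k \<le> indegree a))"

lemma two_le_card_iff:
  assumes "finite S"
  shows "2 \<le> card S \<longleftrightarrow> (\<exists>x \<in> S. \<exists>y \<in> S. x \<noteq> y)"
  using card_le_Suc0_iff_eq[OF assms] by (auto simp: numeral_2_eq_2 not_less_eq_eq[symmetric])

lemma cut_if_longest_path_not_spanning:
  assumes p: "longest_path p" and "set p \<noteq> V"
  shows "\<exists>k. cut_at k"
proof -
  have "set p \<subseteq> V" using p by (auto simp: longest_path_def path_def)
  with assms obtain v where v: "v \<in> V" "v \<notin> set p" by blast
  obtain j where j: "level p j v" using level_exists[OF p v(1)] by blast
  define w where "w = p ! j"
  define A where "A = {x \<in> V. \<exists>i > j. level p i x}"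
  define B where "B = {x \<in> V. \<exists>i < j. level p i x}"
  have w: "w \<in> V" "v \<noteq> w" "level p j w"
    using j v(2) \<open>set p \<subseteq> V\<close> by (auto simp: w_def level_def)
  have lev_j: "x = v \<or> x = w" if "level p j x" for x
    using that same_level_unique[OF p that j] v(2) by (auto simp: level_def w_def)
  have V: "V = A \<union> {v, w} \<union> B"
  proof -
    have "x \<in> A \<union> {v, w} \<union> B" if "x \<in> V" for x
    proof -
      obtain i where "level p i x" using level_exists[OF p \<open>x \<in> V\<close>] by blast
      then show ?thesis using that lev_j[of x] by (cases i j rule: linorder_cases) (auto simp: A_def B_def)
    qed
    then show ?thesis using v w by (auto simp: A_def B_def)
  qed
  have "A \<inter> B = {}"
  proof (rule equals0I)
    fix x assume "x \<in> A \<inter> B"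
    then obtain i l where "level p i x" "level p l x" "l < j" "j < i" by (auto simp: A_def B_def)
    then show False using level_unique[OF p, of i x l] by simp
  qed
  moreover have "x \<notin> A" "x \<notin> B" if "level p j x" for x
    using level_unique[OF p that] by (auto simp: A_def B_def)
  ultimately have disj: "A \<inter> B = {}" "A \<inter> {v, w} = {}" "B \<inter> {v, w} = {}"
    using j w(3) by auto
  have no_arc: "\<not> R a b" if ab: "a \<in> A \<union> {v, w}" "b \<in> B \<union> {v, w}" for a b
  proof -
    obtain i where "level p i a" "j \<le> i" using ab j w by (auto simp: A_def intro: less_imp_le)
    moreover obtain l where "level p l b" "l \<le> j" using ab j w by (auto simp: B_def intro: less_imp_le)
    ultimately show ?thesis using no_arc_across_twins[OF p j v(2)] by blast
  qed
  note deg = indegrees_across_twins[OF v(1) w(1,2) V disj no_arc]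
  have "v \<in> {x \<in> V. indegree x = card B}" "w \<in> {x \<in> V. indegree x = card B}"
    using deg v w by auto
  then have "2 \<le> card {x \<in> V. indegree x = card B}"
    using two_le_card_iff[of "{x \<in> V. indegree x = card B}"] w(2) finite_V by auto
  moreover have "\<not> R a b" if "a \<in> V" "b \<in> V" "indegree b \<le> card B" "card B \<le> indegree a" for a b
  proof -
    have "a \<notin> B" "b \<notin> A" using deg(3,4) that by (metis not_less)+
    then show ?thesis using that no_arc V by blast
  qed
  ultimately show ?thesis unfolding cut_at_def by blast
qed

text \<open>
  An arc from a vertex of indegree at least \<open>k\<close> can only go to a vertex of indegree more than \<open>k\<close>.
\<close>

lemma indegrees_after_cut:
  assumes "cut_at k" and "set xs \<subseteq> V" and "x \<in> V" and "successively R (x # xs)" and "k \<le> indegree x"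
  shows "\<forall>y \<in> set xs. k < indegree y"
  using assms(2-)
proof (induction xs arbitrary: x)
  case (Cons y ys)
  then have "k < indegree y"
    using assms(1) by (auto simp: cut_at_def not_le)
  moreover have "\<forall>z \<in> set ys. k < indegree z"
    using Cons.IH[of y] Cons.prems \<open>k < indegree y\<close> by simp
  ultimately show ?case by simp
qed simp

lemma no_spanning_path_if_cut:
  assumes "cut_at k" and "path p"
  shows "set p \<noteq> V"
proof
  assume V: "set p = V"
  obtain x y where xy: "x \<in> set p" "y \<in> set p" "x \<noteq> y" "indegree x = k" "indegree y = k"
    using assms(1) two_le_card_iff[of "{x \<in> V. indegree x = k}"] finite_V V
    by (auto simp: cut_at_def)
  have *: False if "p = as @ a # bs" "b \<in> set bs" "indegree a = k" "indegree b = k" for as a b bs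
  proof -
    have "successively R (a # bs)"
      using assms(2) that by (auto simp: path_def successively_append_iff)
    moreover have "set bs \<subseteq> V" "a \<in> V" using that(1) V by auto
    ultimately have "\<forall>y \<in> set bs. k < indegree y"
      using indegrees_after_cut[OF assms(1), of bs a] that(3) by simp
    with that(2,4) show False by auto
  qed
  obtain as bs where "p = as @ x # bs" using xy(1) by (meson split_list)
  show False
  proof (cases "y \<in> set bs")
    case True
    with * \<open>p = as @ x # bs\<close> xy show False by blast
  next
    case False
    with \<open>p = as @ x # bs\<close> xy obtain cs ds where "as = cs @ y # ds" by (auto dest: split_list)
    with *[of cs y "ds @ x # bs" x] \<open>p = as @ x # bs\<close> xy show False by simp
  qed
qed

theorem spanning_path_iff_no_cut:
  "(\<exists>p. path p \<and> set p = V) \<longleftrightarrow> \<not> (\<exists>k. cut_at k)"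
proof
  assume "\<exists>p. path p \<and> set p = V"
  then show "\<not> (\<exists>k. cut_at k)" using no_spanning_path_if_cut by blast
next
  assume no_cut: "\<not> (\<exists>k. cut_at k)"
  obtain p where p: "longest_path p" using longest_path_exists by blast
  with no_cut cut_if_longest_path_not_spanning have "set p = V" by blast
  with p show "\<exists>p. path p \<and> set p = V" by (auto simp: longest_path_def)
qed

end

section \<open>Time-bounded program verification\<close>

text \<open>
  Total correctness with a time bound. The rules for the commands state the bound as an explicit
  term, so that a backward proof by these rules builds up the bound of a composed command.
\<close>

definition runs :: "nat \<Rightarrow> com \<Rightarrow> store \<Rightarrow> nat \<Rightarrow> (store \<Rightarrow> bool) \<Rightarrow> bool" where
  "runs W c s t Q \<longleftrightarrow> (\<exists>t' s'. exec W c s t' s' \<and> t' \<le> t \<and> Q s')"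

lemma runs_Assign:
  assumes "fits W s e" and "Q (s\<lparr>reg := (reg s)(r := val s e)\<rparr>)"
  shows "runs W (Assign r e) s (1 + cost e) Q"
  using exec_Assign[OF assms(1)] assms(2) unfolding runs_def by blast

lemma runs_Store:
  assumes "fits W s e" and "fits W s f" and "Q (s\<lparr>mem := (mem s)(val s e := val s f)\<rparr>)"
  shows "runs W (Store e f) s (1 + cost e + cost f) Q"
  using exec_Store[OF assms(1,2)] assms(3) unfolding runs_def by blast

lemma runs_Seq:
  assumes "runs W c s t1 (\<lambda>s'. runs W d s' t2 Q)"
  shows "runs W (Seq c d) s (1 + t1 + t2) Q"
proof -
  obtain u1 r u2 r' where "exec W c s u1 r" "u1 \<le> t1" "exec W d r u2 r'" "u2 \<le> t2" "Q r'"
    using assms unfolding runs_def by blast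
  then show ?thesis
    unfolding runs_def by (intro exI[of _ "1 + u1 + u2"] exI[of _ r']) (simp add: exec_Seq del: One_nat_def)
qed

text \<open>
  The loop runs register \<open>r\<close> through the numbers below the content of register \<open>0\<close>.
\<close>

definition for_loop :: "nat \<Rightarrow> com \<Rightarrow> com" where
  "for_loop r body = Seq (Assign r (Const 0))
     (While (Less (Reg r) (Reg 0)) (Seq body (Assign r (Add (Reg r) (Const 1)))))"

text \<open>
  Apart from the body, an iteration costs 4 for the test, 4 for the increment and 1 for the
  sequencing; setting up and leaving the loop costs 7.
\<close>

lemma runs_for_loop:
  assumes "1 < W" "n < W" and r: "r \<noteq> 0" and n: "reg s 0 = n"
    and init: "Inv 0 (s\<lparr>reg := (reg s)(r := 0)\<rparr>)"
    and step: "\<And>j s'. \<lbrakk>j < n; Inv j s'; reg s' 0 = n; reg s' r = j\<rbrakk> \<Longrightarrow>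
      runs W body s' b (\<lambda>s''. reg s'' 0 = n \<and> reg s'' r = j \<and>
        Inv (Suc j) (s''\<lparr>reg := (reg s'')(r := Suc j)\<rparr>))"
    and final: "\<And>s'. \<lbrakk>Inv n s'; reg s' 0 = n\<rbrakk> \<Longrightarrow> Q s'"
  shows "runs W (for_loop r body) s (n * (b + 9) + 7) Q"
proof -
  let ?e = "Less (Reg r) (Reg 0)"
  let ?c = "Seq body (Assign r (Add (Reg r) (Const 1)))"
  have loop: "runs W (While ?e ?c) s' ((n - j) * (b + 9) + 4) Q"
    if "Inv j s'" "reg s' 0 = n" "reg s' r = j" "j \<le> n" for j s'
    using that
  proof (induction "n - j" arbitrary: j s')
    case 0
    then have "j = n" by simp
    have "exec W (While ?e ?c) s' (1 + cost ?e) s'"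
      by (rule exec_While_false) (use 0 \<open>j = n\<close> assms in \<open>auto simp: fits_def\<close>)
    moreover have "Q s'" using 0 final \<open>j = n\<close> by blast
    ultimately show ?case unfolding runs_def using \<open>j = n\<close> by force
  next
    case (Suc k)
    then have j: "j < n" "n - j = Suc (n - Suc j)" by auto
    have "runs W ?c s' (1 + b + (1 + cost (Add (Reg r) (Const 1))))
      (\<lambda>s''. reg s'' 0 = n \<and> reg s'' r = Suc j \<and> Inv (Suc j) s'')"
    proof (rule runs_Seq)
      show "runs W body s' b (\<lambda>s''. runs W (Assign r (Add (Reg r) (Const 1))) s''
        (1 + cost (Add (Reg r) (Const 1)))
        (\<lambda>s''. reg s'' 0 = n \<and> reg s'' r = Suc j \<and> Inv (Suc j) s''))"
        using step[OF j(1) Suc.prems(1-3)] unfolding runs_def[of W body]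
      proof (elim exE conjE, intro exI conjI)
        fix t' r' assume *: "reg r' 0 = n" "reg r' r = j" "Inv (Suc j) (r'\<lparr>reg := (reg r')(r := Suc j)\<rparr>)"
        show "runs W (Assign r (Add (Reg r) (Const 1))) r' (1 + cost (Add (Reg r) (Const 1)))
          (\<lambda>s''. reg s'' 0 = n \<and> reg s'' r = Suc j \<and> Inv (Suc j) s'')"
          by (rule runs_Assign) (use * r j assms in \<open>auto simp: fits_def\<close>)
      qed
    qed
    then obtain t1 s1 where s1: "exec W ?c s' t1 s1" "t1 \<le> b + 5" "reg s1 0 = n"
      "reg s1 r = Suc j" "Inv (Suc j) s1"
      unfolding runs_def by auto
    have "runs W (While ?e ?c) s1 ((n - Suc j) * (b + 9) + 4) Q"
      by (rule Suc.hyps(1)) (use Suc.hyps(2) j s1 in auto)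
    then obtain t2 s2 where s2: "exec W (While ?e ?c) s1 t2 s2" "t2 \<le> (n - Suc j) * (b + 9) + 4" "Q s2"
      unfolding runs_def by blast
    have "exec W (While ?e ?c) s' (1 + cost ?e + t1 + t2) s2"
      by (rule exec_While_true[OF _ _ s1(1) s2(1)]) (use Suc.prems j assms in \<open>auto simp: fits_def\<close>)
    moreover have "1 + cost ?e + t1 + t2 \<le> (n - j) * (b + 9) + 4"
      using s1(2) s2(2) j(2) by simp
    ultimately show ?case using s2(3) unfolding runs_def by blast
  qed
  have "runs W (for_loop r body) s (1 + (1 + cost (Const 0)) + (n * (b + 9) + 4)) Q"
    unfolding for_loop_def
    by (intro runs_Seq runs_Assign) (use loop[of 0] init n r assms(1) in \<open>auto simp: fits_def\<close>)
  then show ?thesis by (simp add: numeral_eq_Suc)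
qed

text \<open>
  Fills a table of \<open>n\<close> entries. Entry \<open>v\<close> is the final value of an accumulator (register 3) that
  starts at \<open>0\<close> and is updated once for every \<open>u < n\<close>; registers 1 and 2 hold \<open>v\<close> and \<open>u\<close>.
\<close>

definition tabulate :: "expr \<Rightarrow> expr \<Rightarrow> com" where
  "tabulate addr upd = for_loop 1
     (Seq (Assign 3 (Const 0)) (Seq (for_loop 2 (Assign 3 upd)) (Store addr (Reg 3))))"

definition tabulate_time :: "expr \<Rightarrow> expr \<Rightarrow> nat \<Rightarrow> nat" where
  "tabulate_time addr upd n = n * (n * (cost upd + 10) + cost addr + 22) + 7"

text \<open>
  \<open>F v u\<close> is the value of the accumulator for entry \<open>v\<close> after \<open>u\<close> updates. The table is written to
  the cells from \<open>base\<close> on, and the updates may depend only on the cells below \<open>base\<close>.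
\<close>

lemma runs_tabulate:
  assumes W: "1 < W" "n < W" and n: "reg s 0 = n"
    and F: "\<And>v. v < n \<Longrightarrow> F v 0 = 0" "\<And>v. v < n \<Longrightarrow> F v n < W"
    and upd: "\<And>v u s'. \<lbrakk>v < n; u < n; reg s' 0 = n; reg s' 1 = v; reg s' 2 = u; reg s' 3 = F v u;
        \<forall>a < base. mem s' a = mem s a\<rbrakk> \<Longrightarrow> fits W s' upd \<and> val s' upd = F v (Suc u)"
    and addr: "\<And>s'. \<lbrakk>reg s' 0 = n; reg s' 1 < n\<rbrakk> \<Longrightarrow> fits W s' addr \<and> val s' addr = base + reg s' 1"
    and final: "\<And>s'. \<lbrakk>reg s' 0 = n; \<forall>a < base. mem s' a = mem s a;
        \<forall>v < n. mem s' (base + v) = F v n\<rbrakk> \<Longrightarrow> Q s'"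
  shows "runs W (tabulate addr upd) s (tabulate_time addr upd n) Q"
proof -
  define Inv where "Inv v s' \<longleftrightarrow> (\<forall>a < base. mem s' a = mem s a) \<and>
      (\<forall>i < v. mem s' (base + i) = F i n)" for v and s' :: store
  let ?b = "1 + (1 + cost (Const 0)) + (1 + (n * ((1 + cost upd) + 9) + 7) + (1 + cost addr + cost (Reg 3)))"
  have "runs W (tabulate addr upd) s (n * (?b + 9) + 7) Q"
    unfolding tabulate_def
  proof (rule runs_for_loop[where Inv = Inv and n = n, OF W])
    fix v s' assume v: "v < n" "Inv v s'" "reg s' 0 = n" "reg s' 1 = v"
    let ?Q = "\<lambda>s''. reg s'' 0 = n \<and> reg s'' 1 = v \<and> Inv (Suc v) (s''\<lparr>reg := (reg s'')(1 := Suc v)\<rparr>)"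
    define Jnv where "Jnv u r \<longleftrightarrow> reg r 1 = v \<and> reg r 3 = F v u \<and> mem r = mem s'" for u and r :: store
    show "runs W (Seq (Assign 3 (Const 0)) (Seq (for_loop 2 (Assign 3 upd)) (Store addr (Reg 3)))) s' ?b ?Q"
    proof (intro runs_Seq runs_Assign)
      let ?s = "s'\<lparr>reg := (reg s')(3 := val s' (Const 0))\<rparr>"
      show "runs W (for_loop 2 (Assign 3 upd)) ?s (n * ((1 + cost upd) + 9) + 7)
        (\<lambda>r. runs W (Store addr (Reg 3)) r (1 + cost addr + cost (Reg 3)) ?Q)"
      proof (rule runs_for_loop[where Inv = Jnv and n = n, OF W])
        fix u r assume u: "u < n" "Jnv u r" "reg r 0 = n" "reg r 2 = u"
        have "fits W r upd \<and> val r upd = F v (Suc u)"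
          using upd[of v u r] u v by (auto simp: Inv_def Jnv_def)
        then show "runs W (Assign 3 upd) r (1 + cost upd) (\<lambda>r'. reg r' 0 = n \<and> reg r' 2 = u \<and>
          Jnv (Suc u) (r'\<lparr>reg := (reg r')(2 := Suc u)\<rparr>))"
          by (intro runs_Assign) (use u in \<open>auto simp: Jnv_def\<close>)
      next
        fix r assume r: "Jnv n r" "reg r 0 = n"
        have "fits W r addr \<and> val r addr = base + v"
          using addr[of r] r v by (auto simp: Jnv_def)
        then show "runs W (Store addr (Reg 3)) r (1 + cost addr + cost (Reg 3)) ?Q"
          by (intro runs_Store) (use r v F in \<open>auto simp: Jnv_def Inv_def fits_def less_Suc_eq\<close>)
      qed (use v F in \<open>auto simp: Jnv_def\<close>)
    qed (use W in \<open>simp add: fits_def\<close>)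
  qed (use n final in \<open>auto simp: Inv_def\<close>)
  moreover have "n * (?b + 9) + 7 = tabulate_time addr upd n"
    by (simp add: tabulate_time_def algebra_simps)
  ultimately show ?thesis by simp
qed

section \<open>A quadratic program for the indegree criterion\<close>

text \<open>
  The \<open>n * n\<close> cells of the adjacency matrix are followed by the table of indegrees and by a second
  table with \<open>n\<close> entries.
\<close>

definition arc_at :: "expr \<Rightarrow> expr \<Rightarrow> expr" where
  "arc_at u v = Load (Add (Mul u (Reg 0)) v)"

definition degree_addr :: "expr \<Rightarrow> expr" where
  "degree_addr v = Add (Mul (Reg 0) (Reg 0)) v"

definition reach_addr :: "expr \<Rightarrow> expr" where
  "reach_addr v = Add (Add (Mul (Reg 0) (Reg 0)) (Reg 0)) v"

definition degree_upd :: expr where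
  "degree_upd = Add (Reg 3) (arc_at (Reg 2) (Reg 1))"

text \<open>
  Truncated subtraction makes \<open>a + (b - a)\<close> the maximum of \<open>a\<close> and \<open>b\<close>.
\<close>

definition reach_upd :: expr where
  "reach_upd = Add (Reg 3) (Sub (Mul (arc_at (Reg 2) (Reg 1))
     (Add (Load (degree_addr (Reg 2))) (Const 1))) (Reg 3))"

text \<open>
  For the number \<open>k\<close> in register 1, register 3 counts the vertices of indegree \<open>k\<close>, and register 4
  counts the vertices of indegree at most \<open>k\<close> that have an in-neighbour of indegree at least \<open>k\<close>.
\<close>

definition count_step :: com where
  "count_step = Seq (Assign 3 (Add (Reg 3) (Eq (Load (degree_addr (Reg 2))) (Reg 1))))
     (Assign 4 (Add (Reg 4) (Mul (Less (Load (degree_addr (Reg 2))) (Add (Reg 1) (Const 1)))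
       (Less (Reg 1) (Load (reach_addr (Reg 2)))))))"

definition cut_test :: expr where
  "cut_test = Add (Reg 5) (Mul (Less (Const 1) (Reg 3)) (Eq (Reg 4) (Const 0)))"

definition count_cuts :: com where
  "count_cuts = for_loop 1 (Seq (Assign 3 (Const 0)) (Seq (Assign 4 (Const 0))
     (Seq (for_loop 2 count_step) (Assign 5 cut_test))))"

definition hamiltonian_path_prog :: com where
  "hamiltonian_path_prog =
     Seq (tabulate (degree_addr (Reg 1)) degree_upd)
    (Seq (tabulate (reach_addr (Reg 1)) reach_upd)
    (Seq (Assign 5 (Const 0))
    (Seq count_cuts
         (Assign 0 (Mul (Less (Const 0) (Reg 0)) (Eq (Reg 5) (Const 0)))))))"

lemma index_less: "u < n \<Longrightarrow> v < n \<Longrightarrow> u * n + v < n * (n::nat)"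
  using mult_le_mono1[of "Suc u" n n] by simp

locale arc_matrix =
  fixes n :: nat and M :: "nat \<Rightarrow> nat"
  assumes M_le_1: "M a \<le> 1"
begin

text \<open>
  The largest address in use is at most \<open>n * n + 2 * n\<close>.
\<close>

definition W :: nat where "W = (n + 2) ^ 2"

definition deg :: "nat \<Rightarrow> nat" where
  "deg v = (\<Sum>u<n. M (u * n + v))"

text \<open>
  One more than the largest indegree of an in-neighbour of \<open>v\<close>, and \<open>0\<close> if there is none; the shift
  separates the latter case from in-neighbours of indegree \<open>0\<close>. An arc to \<open>v\<close> from a vertex of
  indegree at least \<open>k\<close> exists if and only if \<open>k < reach v\<close>.
\<close>

definition reach :: "nat \<Rightarrow> nat" where
  "reach v = Max (insert 0 ((\<lambda>u. M (u * n + v) * (deg u + 1)) ` {..<n}))"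

definition class_size :: "nat \<Rightarrow> nat" where
  "class_size k = (\<Sum>v<n. of_bool (deg v = k))"

definition crossings :: "nat \<Rightarrow> nat" where
  "crossings k = (\<Sum>v<n. of_bool (deg v < k + 1) * of_bool (k < reach v))"

definition cuts :: nat where
  "cuts = (\<Sum>k<n. of_bool (1 < class_size k) * of_bool (crossings k = 0))"

lemma W_eq: "W = n * n + 4 * n + 4"
  by (simp add: W_def power2_eq_square algebra_simps)

lemma sum_le: "(\<And>i. i < k \<Longrightarrow> f i \<le> 1) \<Longrightarrow> sum f {..<k} \<le> (k::nat)" for f :: "nat \<Rightarrow> nat"
  using sum_bounded_above[of "{..<k}" f 1] by simp

lemma deg_le: "deg v \<le> n"
  unfolding deg_def by (intro sum_le M_le_1)

definition degrees_stored :: "store \<Rightarrow> bool" where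
  "degrees_stored s \<longleftrightarrow> (\<forall>v < n. mem s (n * n + v) = deg v)"

lemma runs_degrees:
  assumes n: "reg s 0 = n" and M: "\<forall>a < n * n. mem s a = M a"
    and final: "\<And>s'. \<lbrakk>reg s' 0 = n; \<forall>a < n * n. mem s' a = M a; degrees_stored s'\<rbrakk> \<Longrightarrow> Q s'"
  shows "runs W (tabulate (degree_addr (Reg 1)) degree_upd) s
    (tabulate_time (degree_addr (Reg 1)) degree_upd n) Q"
proof (rule runs_tabulate[where base = "n * n" and F = "\<lambda>v u. \<Sum>i<u. M (i * n + v)"])
  fix v u and s' :: store assume *: "v < n" "u < n" "reg s' 0 = n" "reg s' 1 = v" "reg s' 2 = u"
    "reg s' 3 = (\<Sum>i<u. M (i * n + v))" "\<forall>a < n * n. mem s' a = mem s a"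
  have "(\<Sum>i<u. M (i * n + v)) \<le> u" by (intro sum_le M_le_1)
  moreover have "u * n + v < n * n" using * by (intro index_less)
  ultimately show "fits W s' degree_upd \<and> val s' degree_upd = (\<Sum>i<Suc u. M (i * n + v))"
    using * M M_le_1[of "u * n + v"] by (simp add: fits_def degree_upd_def arc_at_def W_eq)
next
  fix s' :: store assume "reg s' 0 = n" "\<forall>a < n * n. mem s' a = mem s a"
    "\<forall>v<n. mem s' (n * n + v) = (\<Sum>i<n. M (i * n + v))"
  then show "Q s'" using final M by (simp add: degrees_stored_def deg_def)
next
  fix v show "(\<Sum>i<n. M (i * n + v)) < W"
    using deg_le[of v] by (simp add: deg_def W_eq)
qed (use n in \<open>auto simp: W_eq fits_def degree_addr_def\<close>)

lemma reach_le: "reach v \<le> n + 1"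
proof -
  have "M a * (deg u + 1) \<le> 1 * (n + 1)" for a u
    using M_le_1 deg_le by (intro mult_le_mono) auto
  then show ?thesis unfolding reach_def by (subst Max_le_iff) auto
qed

definition reaches_stored :: "store \<Rightarrow> bool" where
  "reaches_stored s \<longleftrightarrow> (\<forall>v < n. mem s (n * n + n + v) = reach v)"

lemma runs_reaches:
  assumes n: "reg s 0 = n" and M: "\<forall>a < n * n. mem s a = M a" and deg: "degrees_stored s"
    and final: "\<And>s'. \<lbrakk>reg s' 0 = n; degrees_stored s'; reaches_stored s'\<rbrakk> \<Longrightarrow> Q s'"
  shows "runs W (tabulate (reach_addr (Reg 1)) reach_upd) s
    (tabulate_time (reach_addr (Reg 1)) reach_upd n) Q"
proof (rule runs_tabulate[where base = "n * n + n" and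
      F = "\<lambda>v u. Max (insert 0 ((\<lambda>u. M (u * n + v) * (deg u + 1)) ` {..<u}))"])
  fix v u and s' :: store assume *: "v < n" "u < n" "reg s' 0 = n" "reg s' 1 = v" "reg s' 2 = u"
    "reg s' 3 = Max (insert 0 ((\<lambda>u. M (u * n + v) * (deg u + 1)) ` {..<u}))"
    "\<forall>a < n * n + n. mem s' a = mem s a"
  let ?x = "M (u * n + v) * (deg u + 1)"
  let ?S = "insert 0 ((\<lambda>u. M (u * n + v) * (deg u + 1)) ` {..<u})"
  have idx: "u * n + v < n * n" using * by (intro index_less)
  have "mem s' (u * n + v) = M (u * n + v)" "mem s' (n * n + u) = deg u"
    using * M deg idx by (auto simp: degrees_stored_def)
  moreover obtain y where y: "y = Max ?S" by simp
  have "y \<le> reach v"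
    unfolding reach_def y using * by (intro Max_mono) auto
  moreover note reach_le[of v] deg_le[of u] idx *(1-5)
  moreover have "reg s' 3 = y" using *(6) by (simp only: y)
  moreover have "M (u * n + v) = 0 \<or> M (u * n + v) = 1"
    using M_le_1[of "u * n + v"] by linarith
  ultimately have "fits W s' reach_upd \<and> val s' reach_upd = max ?x y"
    by (auto simp: fits_def reach_upd_def arc_at_def degree_addr_def W_eq)
  moreover have "Max (insert 0 ((\<lambda>u. M (u * n + v) * (deg u + 1)) ` {..<Suc u})) = max ?x y"
    unfolding y lessThan_Suc image_insert by (subst insert_commute, subst Max_insert) auto
  ultimately show "fits W s' reach_upd \<and>
      val s' reach_upd = Max (insert 0 ((\<lambda>u. M (u * n + v) * (deg u + 1)) ` {..<Suc u}))"
    by simp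
next
  fix s' :: store assume "reg s' 0 = n" "\<forall>a < n * n + n. mem s' a = mem s a"
    "\<forall>v<n. mem s' (n * n + n + v) = Max (insert 0 ((\<lambda>u. M (u * n + v) * (deg u + 1)) ` {..<n}))"
  then show "Q s'"
    using final deg by (simp add: degrees_stored_def reaches_stored_def reach_def)
next
  fix v show "Max (insert 0 ((\<lambda>u. M (u * n + v) * (deg u + 1)) ` {..<n})) < W"
    by (rule le_less_trans[OF reach_le[of v, unfolded reach_def]]) (simp add: W_eq)
qed (use n in \<open>auto simp: W_eq fits_def reach_addr_def\<close>)

definition count_cuts_time :: nat where
  "count_cuts_time = n * (n * 45 + 33) + 7"

lemma runs_count_step:
  assumes "k < n" "v < n" "reg s 0 = n" "reg s 1 = k" "reg s 2 = v"
    and stored: "degrees_stored s" "reaches_stored s"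
    and acc: "reg s 3 \<le> n" "reg s 4 \<le> n"
    and final: "Q (s\<lparr>reg := (reg s)(3 := reg s 3 + of_bool (deg v = k),
      4 := reg s 4 + of_bool (deg v < k + 1) * of_bool (k < reach v))\<rparr>)"
  shows "runs W count_step s 36 Q"
proof -
  have *: "mem s (n * n + v) = deg v" "mem s (n * n + n + v) = reach v"
    using stored assms(2) by (auto simp: degrees_stored_def reaches_stored_def)
  note bounds = deg_le[of v] reach_le[of v]
  have "runs W count_step s (1 + (1 + 10) + (1 + 23)) Q"
    unfolding count_step_def
  proof (rule runs_Seq)
    let ?e = "Add (Reg 3) (Eq (Load (degree_addr (Reg 2))) (Reg 1))"
    let ?f = "Add (Reg 4) (Mul (Less (Load (degree_addr (Reg 2))) (Add (Reg 1) (Const 1)))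
       (Less (Reg 1) (Load (reach_addr (Reg 2)))))"
    let ?s = "s\<lparr>reg := (reg s)(3 := val s ?e)\<rparr>"
    have cost: "cost ?e = 10" "cost ?f = 23"
      by (simp_all add: degree_addr_def reach_addr_def)
    have second: "runs W (Assign 4 ?f) ?s (1 + cost ?f) Q"
      by (rule runs_Assign)
        (use assms * bounds in \<open>auto simp: fits_def degree_addr_def reach_addr_def W_eq of_bool_def\<close>)
    have "fits W s ?e"
      using assms(1-7) acc * bounds by (auto simp: fits_def degree_addr_def W_eq of_bool_def)
    then have "runs W (Assign 3 ?e) s (1 + cost ?e) (\<lambda>s. runs W (Assign 4 ?f) s (1 + cost ?f) Q)"
      using second by (rule runs_Assign)
    then show "runs W (Assign 3 ?e) s (1 + 10) (\<lambda>s. runs W (Assign 4 ?f) s (1 + 23) Q)"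
      by (simp only: cost)
  qed
  then show ?thesis by simp
qed

lemma runs_count_cuts:
  assumes n: "reg s 0 = n" and stored: "degrees_stored s" "reaches_stored s" and cuts0: "reg s 5 = 0"
    and final: "\<And>s'. \<lbrakk>reg s' 0 = n; reg s' 5 = cuts\<rbrakk> \<Longrightarrow> Q s'"
  shows "runs W count_cuts s count_cuts_time Q"
proof -
  have W: "1 < W" "n < W" by (simp_all add: W_eq)
  define size where "size k v = (\<Sum>i<v. of_bool (deg i = k) :: nat)" for k v
  define cross where "cross k v = (\<Sum>i<v. of_bool (deg i < k + 1) * of_bool (k < reach i) :: nat)" for k v
  define num where "num k = (\<Sum>i<k. of_bool (1 < class_size i) * of_bool (crossings i = 0) :: nat)" for k
  have size_le: "size k v \<le> v" and cross_le: "cross k v \<le> v" and num_le: "num k \<le> k" for k v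
    unfolding size_def cross_def num_def by (intro sum_le; simp)+
  define Inv where "Inv k s' \<longleftrightarrow> mem s' = mem s \<and> reg s' 5 = num k" for k and s' :: store
  let ?b = "1 + (1 + cost (Const 0)) + (1 + (1 + cost (Const 0)) + (1 + (n * (36 + 9) + 7) + (1 + cost cut_test)))"
  have "runs W count_cuts s (n * (?b + 9) + 7) Q"
    unfolding count_cuts_def
  proof (rule runs_for_loop[where Inv = Inv and n = n, OF W])
    fix k and s' :: store assume k: "k < n" "Inv k s'" "reg s' 0 = n" "reg s' 1 = k"
    let ?Q = "\<lambda>s''. reg s'' 0 = n \<and> reg s'' 1 = k \<and> Inv (Suc k) (s''\<lparr>reg := (reg s'')(1 := Suc k)\<rparr>)"
    define Jnv where "Jnv v r \<longleftrightarrow> reg r 1 = k \<and> reg r 3 = size k v \<and> reg r 4 = cross k v \<and>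
      reg r 5 = num k \<and> mem r = mem s" for v and r :: store
    show "runs W (Seq (Assign 3 (Const 0)) (Seq (Assign 4 (Const 0))
      (Seq (for_loop 2 count_step) (Assign 5 cut_test)))) s' ?b ?Q"
    proof (intro runs_Seq runs_Assign)
      let ?s1 = "s'\<lparr>reg := (reg s')(3 := val s' (Const 0))\<rparr>"
      let ?s = "?s1\<lparr>reg := (reg ?s1)(4 := val ?s1 (Const 0))\<rparr>"
      show "runs W (for_loop 2 count_step) ?s (n * (36 + 9) + 7)
        (\<lambda>r. runs W (Assign 5 cut_test) r (1 + cost cut_test) ?Q)"
      proof (rule runs_for_loop[where Inv = Jnv and n = n, OF W])
        fix v and r :: store assume v: "v < n" "Jnv v r" "reg r 0 = n" "reg r 2 = v"
        show "runs W count_step r 36 (\<lambda>r'. reg r' 0 = n \<and> reg r' 2 = v \<and>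
          Jnv (Suc v) (r'\<lparr>reg := (reg r')(2 := Suc v)\<rparr>))"
          by (rule runs_count_step[where k = k and v = v])
            (use k v stored size_le[of k v] cross_le[of k v] in
              \<open>auto simp: Jnv_def degrees_stored_def reaches_stored_def size_def cross_def\<close>)
      next
        fix r :: store assume r: "Jnv n r" "reg r 0 = n"
        have *: "size k n = class_size k" "cross k n = crossings k"
          by (simp_all add: size_def cross_def class_size_def crossings_def)
        show "runs W (Assign 5 cut_test) r (1 + cost cut_test) ?Q"
          by (rule runs_Assign)
            (use r k * num_le[of k] size_le[of k n] cross_le[of k n] in
              \<open>auto simp: Jnv_def Inv_def fits_def cut_test_def W_eq num_def of_bool_def\<close>)
      qed (use k in \<open>auto simp: Jnv_def Inv_def size_def cross_def\<close>)
    qed (use W in \<open>auto simp: fits_def\<close>)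
  qed (use n cuts0 final in \<open>auto simp: Inv_def num_def cuts_def\<close>)
  moreover have "n * (?b + 9) + 7 = count_cuts_time"
    by (simp add: count_cuts_time_def cut_test_def algebra_simps)
  ultimately show ?thesis by simp
qed

lemma runs_hamiltonian_path_prog:
  assumes n: "reg s 0 = n" and M: "\<forall>a < n * n. mem s a = M a"
  shows "runs W hamiltonian_path_prog s (100 * (n + 1) ^ 2) (\<lambda>s'. reg s' 0 \<noteq> 0 \<longleftrightarrow> 0 < n \<and> cuts = 0)"
    (is "runs W _ s _ ?Q")
proof -
  let ?t1 = "tabulate_time (degree_addr (Reg 1)) degree_upd n"
  let ?t2 = "tabulate_time (reach_addr (Reg 1)) reach_upd n"
  let ?answer = "Mul (Less (Const 0) (Reg 0)) (Eq (Reg 5) (Const 0))"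
  have cuts_le: "cuts \<le> n"
    unfolding cuts_def by (intro sum_le) simp
  have "runs W hamiltonian_path_prog s
    (1 + ?t1 + (1 + ?t2 + (1 + (1 + cost (Const 0)) + (1 + count_cuts_time + (1 + cost ?answer))))) ?Q"
    unfolding hamiltonian_path_prog_def
  proof (intro runs_Seq runs_degrees[OF n M] runs_reaches runs_Assign runs_count_cuts)
    fix s' :: store assume "reg s' 0 = n" "reg s' 5 = cuts"
    then show "fits W s' ?answer"
      "?Q (s'\<lparr>reg := (reg s')(0 := val s' ?answer)\<rparr>)"
      using cuts_le by (auto simp: fits_def W_eq)
  qed (auto simp: fits_def W_eq degrees_stored_def reaches_stored_def)
  moreover have "1 + ?t1 + (1 + ?t2 + (1 + (1 + cost (Const 0)) + (1 + count_cuts_time + (1 + cost ?answer))))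
    \<le> 100 * (n + 1) ^ 2"
    by (simp add: tabulate_time_def count_cuts_time_def degree_addr_def reach_addr_def degree_upd_def
        reach_upd_def arc_at_def power2_eq_square algebra_simps)
  ultimately show ?thesis unfolding runs_def using order.trans by blast
qed

text \<open>
  The counters detect the combinatorial criterion, in terms of the indices of the vertices.
\<close>

lemma cuts_eq_0_iff:
  "cuts = 0 \<longleftrightarrow> \<not> (\<exists>k < n. 2 \<le> class_size k \<and>
     (\<forall>u < n. \<forall>v < n. M (u * n + v) \<noteq> 0 \<longrightarrow> \<not> (deg v \<le> k \<and> k \<le> deg u)))"
proof -
  have reach: "reach v \<le> k \<longleftrightarrow> (\<forall>u < n. M (u * n + v) \<noteq> 0 \<longrightarrow> deg u < k)" for v k
  proof -
    have "M (u * n + v) * (deg u + 1) \<le> k \<longleftrightarrow> (M (u * n + v) \<noteq> 0 \<longrightarrow> deg u < k)" for u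
    proof -
      have "M (u * n + v) = 0 \<or> M (u * n + v) = 1"
        using M_le_1[of "u * n + v"] by linarith
      then show ?thesis by auto
    qed
    then show ?thesis unfolding reach_def by (subst Max_le_iff) auto
  qed
  have crossings: "crossings k = 0 \<longleftrightarrow> (\<forall>v < n. deg v \<le> k \<longrightarrow> reach v \<le> k)" for k
    unfolding crossings_def by (auto simp: not_less less_Suc_eq_le)
  have "crossings k = 0 \<longleftrightarrow>
      (\<forall>u < n. \<forall>v < n. M (u * n + v) \<noteq> 0 \<longrightarrow> \<not> (deg v \<le> k \<and> k \<le> deg u))" for k
    unfolding crossings reach by (meson not_le)
  moreover have "cuts = 0 \<longleftrightarrow> (\<forall>k < n. \<not> (2 \<le> class_size k \<and> crossings k = 0))"
    unfolding cuts_def by (subst sum_eq_0_iff) (auto simp: of_bool_def)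
  ultimately show ?thesis by blast
qed

end

section \<open>Semicomplete multipartite digraphs with independence number at most two\<close>

text \<open>
  Two nonneighbours of a vertex \<open>x\<close> lie in the color class of \<open>x\<close>, so that the three of them are
  independent.
\<close>

lemma near_semicomplete_if_independence_number_le_2:
  assumes D: "semicomplete_multipartite D" and indep: "independence_number D \<le> 2"
  shows "near_semicomplete (pverts D) (\<lambda>u v. u \<rightarrow>\<^bsub>D\<^esub> v)"
proof -
  interpret pair_digraph D using D by (simp add: semicomplete_multipartite_def)
  from D obtain \<C> where part: "partition_on (pverts D) \<C>" and
    classes: "\<forall>u \<in> pverts D. \<forall>v \<in> pverts D. u \<noteq> v \<longrightarrow>
      (u \<rightarrow>\<^bsub>D\<^esub> v \<or> v \<rightarrow>\<^bsub>D\<^esub> u) \<longleftrightarrow> \<not> (\<exists>C \<in> \<C>. u \<in> C \<and> v \<in> C)"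
    unfolding semicomplete_multipartite_def by (elim conjE exE)
  have adj: "(u \<rightarrow>\<^bsub>D\<^esub> v \<or> v \<rightarrow>\<^bsub>D\<^esub> u) \<longleftrightarrow> \<not> (\<exists>C \<in> \<C>. u \<in> C \<and> v \<in> C)"
    if "u \<in> pverts D" "v \<in> pverts D" "u \<noteq> v" for u v
    using classes that by (simp only: simp_thms Ball_def)
  show ?thesis
  proof
    show "finite (pverts D)" by (rule pair_finite_verts)
    show no_loop: "\<not> x \<rightarrow>\<^bsub>D\<^esub> x" for x using pair_no_loops[of "(x, x)"] by auto
    fix x y z assume xyz: "x \<in> pverts D" "y \<in> pverts D" "z \<in> pverts D" "y \<noteq> x" "z \<noteq> x" "y \<noteq> z"
    show "x \<rightarrow>\<^bsub>D\<^esub> y \<or> y \<rightarrow>\<^bsub>D\<^esub> x \<or> x \<rightarrow>\<^bsub>D\<^esub> z \<or> z \<rightarrow>\<^bsub>D\<^esub> x"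
    proof (rule ccontr)
      assume non: "\<not> ?thesis"
      have "\<exists>C \<in> \<C>. x \<in> C \<and> y \<in> C" "\<exists>C \<in> \<C>. x \<in> C \<and> z \<in> C"
        using non adj[of x y] adj[of x z] xyz by metis+
      then obtain C C' where C: "C \<in> \<C>" "x \<in> C" "y \<in> C" "C' \<in> \<C>" "x \<in> C'" "z \<in> C'"
        by blast
      then have "C = C'"
        using disjointD[OF partition_onD2[OF part], of C C'] by blast
      then have "\<exists>C \<in> \<C>. y \<in> C \<and> z \<in> C"
        using C by blast
      then have "\<not> y \<rightarrow>\<^bsub>D\<^esub> z \<and> \<not> z \<rightarrow>\<^bsub>D\<^esub> y"
        using adj[of y z] xyz by simp
      then have "independent_in D {x, y, z}"
        using non no_loop xyz by (simp add: independent_in_def)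
      moreover have "finite {S. independent_in D S}"
        by (rule finite_subset[of _ "Pow (pverts D)"])
          (auto simp: independent_in_def pair_finite_verts)
      ultimately have "card {x, y, z} \<le> independence_number D"
        unfolding independence_number_def by (intro Max_ge) auto
      then show False using indep xyz by simp
    qed
  qed
qed

lemma set_vwalk_arcs_subset_iff:
  "set (vwalk_arcs p) \<subseteq> A \<longleftrightarrow> successively (\<lambda>u v. (u, v) \<in> A) p"
  by (induction p rule: vwalk_arcs.induct) auto

text \<open>
  A Hamiltonian path has at least one vertex, while \<open>near_semicomplete.path\<close> admits the empty list.
\<close>

lemma has_hamiltonian_path_iff:
  fixes D :: "'a pair_pre_digraph"
  assumes "near_semicomplete (pverts D) (\<lambda>u v. u \<rightarrow>\<^bsub>D\<^esub> v)"
  shows "has_hamiltonian_path D \<longleftrightarrow> pverts D \<noteq> {} \<and>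
    (\<exists>p. near_semicomplete.path (pverts D) (\<lambda>u v. u \<rightarrow>\<^bsub>D\<^esub> v) p \<and> set p = pverts D)"
proof -
  interpret near_semicomplete "pverts D" "\<lambda>u v. u \<rightarrow>\<^bsub>D\<^esub> v" by fact
  have vpath_iff: "vpath p D \<longleftrightarrow> set p \<noteq> {} \<and> path p" for p
    unfolding path_def vpath_def vwalk_def
    unfolding set_vwalk_arcs_subset_iff with_proj_simps set_empty
    by (rule iffI; elim conjE; intro conjI; assumption)
  show ?thesis
    unfolding has_hamiltonian_path_def vpath_iff
  proof
    assume "\<exists>p. (set p \<noteq> {} \<and> path p) \<and> set p = pverts D"
    then obtain p where "set p \<noteq> {}" "path p" "set p = pverts D" by (elim exE conjE)
    then show "pverts D \<noteq> {} \<and> (\<exists>p. path p \<and> set p = pverts D)"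
      by (intro conjI exI[of _ p]) simp_all
  next
    assume "pverts D \<noteq> {} \<and> (\<exists>p. path p \<and> set p = pverts D)"
    then obtain p where "pverts D \<noteq> {}" "path p" "set p = pverts D" by (elim exE conjE)
    then show "\<exists>p. (set p \<noteq> {} \<and> path p) \<and> set p = pverts D"
      by (intro conjI exI[of _ p]) simp_all
  qed
qed

lemma sum_of_bool_nth_eq_card:
  assumes "distinct xs"
  shows "(\<Sum>i<length xs. of_bool (P (xs ! i)) :: nat) = card {x \<in> set xs. P x}"
proof -
  have "(\<Sum>i<length xs. of_bool (P (xs ! i)) :: nat) = (\<Sum>x\<in>set xs. of_bool (P x))"
    by (rule sum.reindex_bij_betw[OF bij_betw_nth]) (use assms in auto)
  also have "\<dots> = card {x \<in> set xs. P x}"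
    by (simp add: Collect_conj_eq)
  finally show ?thesis .
qed

lemma hamiltonian_path_prog_correct:
  fixes D :: "'a pair_pre_digraph"
  assumes D: "semicomplete_multipartite D" "independence_number D \<le> 2"
    and vs: "distinct vs" "set vs = pverts D"
  shows "runs ((length vs + 2) ^ 2) hamiltonian_path_prog (adjacency_input D vs)
    (100 * (length vs + 1) ^ 2) (\<lambda>s. reg s 0 \<noteq> 0 \<longleftrightarrow> has_hamiltonian_path D)"
proof -
  let ?R = "\<lambda>u v. u \<rightarrow>\<^bsub>D\<^esub> v" and ?n = "length vs"
  interpret near_semicomplete "pverts D" ?R
    using D by (rule near_semicomplete_if_independence_number_le_2)
  define M where "M = mem (adjacency_input D vs)"
  interpret arc_matrix ?n M
    by standard (simp add: M_def adjacency_input_def Let_def)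
  have M: "M (u * ?n + v) = of_bool (?R (vs ! u) (vs ! v))" if "u < ?n" "v < ?n" for u v
  proof -
    have "?n \<noteq> 0" using that by auto
    then have "(u * ?n + v) div ?n = u" "(u * ?n + v) mod ?n = v"
      using that div_mult_self3[of ?n u v] by auto
    then show ?thesis using index_less[OF that] that by (simp add: M_def adjacency_input_def Let_def)
  qed
  have deg: "deg v = indegree (vs ! v)" if "v < ?n" for v
    using sum_of_bool_nth_eq_card[OF vs(1), of "\<lambda>u. ?R u (vs ! v)"] M that vs(2)
    by (simp add: deg_def)
  have size: "class_size k = card {x \<in> pverts D. indegree x = k}" for k
    using sum_of_bool_nth_eq_card[OF vs(1), of "\<lambda>x. indegree x = k"] deg vs(2)
    by (simp add: class_size_def)
  have "(\<exists>k < ?n. 2 \<le> class_size k \<and>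
     (\<forall>u < ?n. \<forall>v < ?n. M (u * ?n + v) \<noteq> 0 \<longrightarrow> \<not> (deg v \<le> k \<and> k \<le> deg u))) \<longleftrightarrow> (\<exists>k. cut_at k)"
  proof -
    have all: "(\<forall>x \<in> pverts D. P x) \<longleftrightarrow> (\<forall>i < ?n. P (vs ! i))" for P
      using vs(2) all_set_conv_all_nth[of vs P] by simp
    have "cut_at k \<longleftrightarrow> 2 \<le> class_size k \<and>
      (\<forall>u < ?n. \<forall>v < ?n. M (u * ?n + v) \<noteq> 0 \<longrightarrow> \<not> (deg v \<le> k \<and> k \<le> deg u))" for k
      unfolding cut_at_def all size using M deg by simp
    \<comment> \<open>the program tests only \<open>k < n\<close>, but all indegrees are below \<open>n\<close>\<close>
    moreover have "k < ?n" if k: "cut_at k" for k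
    proof -
      have "2 \<le> card {x \<in> pverts D. indegree x = k}"
        using k unfolding cut_at_def by (rule conjunct1)
      then have "0 < card {x \<in> pverts D. indegree x = k}"
        by linarith
      then have "{x \<in> pverts D. indegree x = k} \<noteq> {}"
        unfolding card_gt_0_iff by (rule conjunct1)
      then obtain x where x: "x \<in> pverts D" "indegree x = k" by blast
      have "{u \<in> pverts D. ?R u x} \<subset> pverts D" using x irrefl by blast
      then have "indegree x < card (pverts D)" by (rule psubset_card_mono[OF finite_V])
      then show ?thesis using x vs distinct_card[of vs] by simp
    qed
    ultimately show ?thesis by blast
  qed
  then have "cuts = 0 \<longleftrightarrow> (\<exists>p. path p \<and> set p = pverts D)"
    unfolding cuts_eq_0_iff spanning_path_iff_no_cut by simp
  moreover have "0 < ?n \<longleftrightarrow> pverts D \<noteq> {}" using vs(2) by auto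
  ultimately have "0 < ?n \<and> cuts = 0 \<longleftrightarrow> has_hamiltonian_path D"
    using has_hamiltonian_path_iff[OF near_semicomplete_axioms] by simp
  moreover have "runs W hamiltonian_path_prog (adjacency_input D vs) (100 * (?n + 1) ^ 2)
      (\<lambda>s. reg s 0 \<noteq> 0 \<longleftrightarrow> 0 < ?n \<and> cuts = 0)"
    by (rule runs_hamiltonian_path_prog) (simp_all add: M_def adjacency_input_def Let_def)
  ultimately show ?thesis by (simp add: W_def)
qed

theorem corollary4p7:
  shows "solvable_in_time_on has_hamiltonian_path (\<lambda>n. real n ^ 2)
    (\<lambda>D. semicomplete_multipartite D \<and> independence_number D \<le> 2)"
  unfolding solvable_in_time_on_def
proof (rule exI[of _ hamiltonian_path_prog], rule exI[of _ 2], rule exI[of _ "\<lambda>n. 100 * (n + 1) ^ 2"],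
    rule conjI, goal_cases)
  case 1
  show ?case
  proof (rule bigoI[of _ 400])
    have "real (100 * (n + 1) ^ 2) \<le> 400 * real n ^ 2" if "1 \<le> n" for n
    proof -
      have "100 * (n + 1) ^ 2 \<le> 100 * (2 * n) ^ 2" using that by (intro mult_le_mono2 power_mono) auto
      also have "\<dots> = 400 * n ^ 2" by (simp add: power_mult_distrib)
      finally have "real (100 * (n + 1) ^ 2) \<le> real (400 * n ^ 2)" by (rule of_nat_mono)
      then show ?thesis by simp
    qed
    then show "\<forall>\<^sub>F n in at_top. norm (real (100 * (n + 1) ^ 2)) \<le> 400 * norm (real n ^ 2)"
      by (intro eventually_sequentiallyI[of 1]) simp
  qed
next
  case 2
  show ?case
  proof (intro allI impI)
    fix D :: "nat pair_pre_digraph" and vs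
    assume *: "pair_digraph D \<and> (semicomplete_multipartite D \<and> independence_number D \<le> 2) \<and>
      distinct vs \<and> set vs = pverts D"
    then have "runs ((length vs + 2) ^ 2) hamiltonian_path_prog (adjacency_input D vs)
      (100 * (length vs + 1) ^ 2) (\<lambda>s. reg s 0 \<noteq> 0 \<longleftrightarrow> has_hamiltonian_path D)"
      by (intro hamiltonian_path_prog_correct) simp_all
    moreover have "length vs = card (pverts D)" using * distinct_card[of vs] by simp
    ultimately show "\<exists>t s. exec ((length vs + 2) ^ 2) hamiltonian_path_prog (adjacency_input D vs) t s \<and>
        t \<le> 100 * (card (pverts D) + 1) ^ 2 \<and> (reg s 0 \<noteq> 0 \<longleftrightarrow> has_hamiltonian_path D)"
      unfolding runs_def by simp
  qed
qed

end
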